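(* Let $G = K_1$ and let $H$ be a connected graph of order $m \ge 1$. Then $\mu(G \odot H) = m+1$ if $H$ is complete, and $\mu(G\odot H) = m$ if $H$ is not complete.
   Context: All graphs are finite, simple, undirected and connected. For a graph $G$ and $X \subseteq V(G)$, two vertices $u,v$ are $X$-visible if there exists a shortest $(u,v)$-path $P$ in $G$ with $V(P)\cap X \subseteq \{u,v\}$. A set $X\subseteq V(G)$ is a mutual-visibility set of $G$ if every two vertices of $X$ are $X$-visible; $\mu(G)$ denotes the maximum cardinality of a mutual-visibility set of $G$. The corona $G\odot H$ is obtained from one copy of $G$ and $|V(G)|$ copies of $H$, the copy associated with $v\in V(G)$ being denoted $H_v$, by joining each $v \in V(G)$ to every vertex of $H_v$ (so $K_1\odot H$ is $H$ with one new vertex adjacent to all vertices of $H$). *)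

theory Defs
  imports Graph_Theory.Graph_Theory
begin

text \<open>
  A finite simple undirected graph is a \<open>pair_graph\<close>: an edge is a pair of opposite arcs,
  and a path is given by its list of arcs.
\<close>

definition shortest_path ::
    "'a pair_pre_digraph \<Rightarrow> 'a \<Rightarrow> ('a \<times> 'a) awalk \<Rightarrow> 'a \<Rightarrow> bool" where
  "shortest_path G u p v \<longleftrightarrow>
     pre_digraph.apath (with_proj G) u p v \<and>
     (\<forall>q. pre_digraph.apath (with_proj G) u q v \<longrightarrow> length p \<le> length q)"

definition visible :: "'a pair_pre_digraph \<Rightarrow> 'a set \<Rightarrow> 'a \<Rightarrow> 'a \<Rightarrow> bool" where
  "visible G X u v \<longleftrightarrow>
     (\<exists>p. shortest_path G u p v \<and> set (pawalk_verts u p) \<inter> X \<subseteq> {u, v})"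

definition mutual_visibility_set :: "'a pair_pre_digraph \<Rightarrow> 'a set \<Rightarrow> bool" where
  "mutual_visibility_set G X \<longleftrightarrow>
     X \<subseteq> pverts G \<and> (\<forall>u\<in>X. \<forall>v\<in>X. u \<noteq> v \<longrightarrow> visible G X u v)"

definition mutual_visibility_number :: "'a pair_pre_digraph \<Rightarrow> nat" where
  "mutual_visibility_number G = Max (card ` {X. mutual_visibility_set G X})"

text \<open>
  In the corona, \<open>Inl v\<close> is the vertex \<open>v\<close> of \<open>G\<close>, and \<open>Inr (v, x)\<close>
  is the vertex \<open>x\<close> of the copy of \<open>H\<close> associated with \<open>v\<close>.
\<close>

definition corona ::
    "'a pair_pre_digraph \<Rightarrow> 'b pair_pre_digraph \<Rightarrow> ('a + 'a \<times> 'b) pair_pre_digraph"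
    (infixl "\<odot>" 70) where
  "G \<odot> H = \<lparr>
     pverts = Inl ` pverts G \<union> Inr ` (pverts G \<times> pverts H),
     parcs =
       {(Inl u, Inl v) | u v. (u, v) \<in> parcs G} \<union>
       {(Inr (v, x), Inr (v, y)) | v x y. v \<in> pverts G \<and> (x, y) \<in> parcs H} \<union>
       {(Inl v, Inr (v, x)) | v x. v \<in> pverts G \<and> x \<in> pverts H} \<union>
       {(Inr (v, x), Inl v) | v x. v \<in> pverts G \<and> x \<in> pverts H}\<rparr>"

lemma pair_graph_corona:
  assumes "pair_graph G" "pair_graph H"
  shows "pair_graph (G \<odot> H)"
proof -
  interpret G: pair_graph G by fact
  interpret H: pair_graph H by fact
  have wf: "parcs (G \<odot> H) \<subseteq> pverts (G \<odot> H) \<times> pverts (G \<odot> H)"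
    by (auto simp: corona_def dest: G.in_arcsD1 G.in_arcsD2 H.in_arcsD1 H.in_arcsD2)
  have fin: "finite (pverts (G \<odot> H))"
    using G.pair_finite_verts H.pair_finite_verts by (simp add: corona_def)
  have "sym (parcs (G \<odot> H))"
    by (rule symI) (auto simp: corona_def dest: G.arcs_symmetric H.arcs_symmetric)
  moreover have "fst e \<noteq> snd e" if "e \<in> parcs (G \<odot> H)" for e
    using that by (auto simp: corona_def dest: G.no_loops H.no_loops)
  moreover have "finite (parcs (G \<odot> H))"
    using finite_subset[OF wf] fin by simp
  ultimately show ?thesis
    using wf fin by unfold_locales (auto simp: symmetric_def)
qed

end

theory Submission
  imports Defs
begin

text \<open>
  The vertex of \<open>K\<^sub>1\<close> is adjacent to every other vertex of the corona, so two nonadjacent vertices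
  are joined by a shortest path through it, and all the other vertices together form a
  mutual-visibility set. The whole vertex set is one only if no shortest path has
  an inner vertex, that is, only if the corona, and hence \<open>H\<close>, is complete.
\<close>

text \<open>Both \<open>pcas\<close> and \<open>pawalk_verts\<close> recurse over the list of arcs,
  so in this form short paths can be checked by simplification.\<close>

lemma apath_with_proj_iff:
  "pre_digraph.apath (with_proj G) u p v \<longleftrightarrow>
     u \<in> pverts G \<and> set p \<subseteq> parcs G \<and> pcas u p v \<and> distinct (pawalk_verts u p)"
  by (simp add: pre_digraph.apath_def pre_digraph.awalk_def cas_with_proj_eq
      awalk_verts_with_proj_eq)

lemma pcas_end_in_pawalk_verts: "pcas u p v \<Longrightarrow> v \<in> set (pawalk_verts u p)"
  by (induction p arbitrary: u) auto

text \<open>The empty walk ends where it starts, so a single arc between distinct vertices is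
  already shortest. It has no inner vertex that could lie in \<open>X\<close>.\<close>

lemma (in pair_wf_digraph) visible_if_arc:
  assumes "(u, v) \<in> parcs G" "u \<noteq> v"
  shows "visible G X u v"
proof -
  have "length [(u, v)] \<le> length q" if "pre_digraph.apath (with_proj G) u q v" for q
    using that \<open>u \<noteq> v\<close> by (cases q) (auto simp: apath_with_proj_iff)
  then have "shortest_path G u [(u, v)] v"
    using assms by (auto simp: shortest_path_def apath_with_proj_iff dest: in_arcsD1)
  then show ?thesis
    unfolding visible_def by (rule exI[where x = "[(u, v)]", OF conjI]) auto
qed

text \<open>If \<open>u\<close> and \<open>v\<close> are not adjacent, lengths 0 and 1 are
  impossible, so the path through \<open>w\<close> is shortest, and its only inner vertex
  \<open>w\<close> avoids \<open>X\<close>.\<close>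

lemma (in pair_loopfree_digraph) visible_through:
  assumes "(u, w) \<in> parcs G" "(w, v) \<in> parcs G" "u \<noteq> v" "w \<notin> X"
  shows "visible G X u v"
proof (cases "(u, v) \<in> parcs G")
  case True
  then show ?thesis
    using \<open>u \<noteq> v\<close> by (rule visible_if_arc)
next
  case False
  let ?p = "[(u, w), (w, v)]"
  have "length ?p \<le> length q" if "pre_digraph.apath (with_proj G) u q v" for q
  proof (cases q)
    case Nil
    then show ?thesis
      using that \<open>u \<noteq> v\<close> by (simp add: apath_with_proj_iff)
  next
    case (Cons e es)
    then show ?thesis
      using that False by (cases e; cases es) (auto simp: apath_with_proj_iff)
  qed
  moreover have "u \<noteq> w" "w \<noteq> v"
    using assms(1,2) by (auto dest: pair_no_loops)
  ultimately have "shortest_path G u ?p v"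
    using assms by (auto simp: shortest_path_def apath_with_proj_iff dest: in_arcsD1)
  then show ?thesis
    unfolding visible_def using \<open>w \<notin> X\<close> by (intro exI[of _ ?p]) auto
qed

text \<open>When every vertex is an obstacle, a witnessing path cannot have an inner vertex, so its
  first arc must already end in \<open>v\<close>.\<close>

lemma (in pair_wf_digraph) visible_pverts_imp_arc:
  assumes "visible G (pverts G) u v" "u \<noteq> v"
  shows "(u, v) \<in> parcs G"
proof -
  obtain p where p: "u \<in> pverts G" "set p \<subseteq> parcs G" "pcas u p v" "distinct (pawalk_verts u p)"
    and inner: "set (pawalk_verts u p) \<inter> pverts G \<subseteq> {u, v}"
    using assms(1) by (auto simp: visible_def shortest_path_def apath_with_proj_iff)
  obtain e es where pe: "p = e # es"
    using p(3) \<open>u \<noteq> v\<close> by (cases p) auto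
  then have e: "fst e = u" "e \<in> parcs G" "pcas (snd e) es v"
    using p by auto
  have "snd e = v"
  proof (cases es)
    case Nil
    then show ?thesis
      using e by simp
  next
    case (Cons f fs)
    have f: "fst f = snd e" "pcas (snd f) fs v"
      using e(3) Cons by auto
    have "snd e \<in> pverts G"
      using e(2) by (rule arc_snd_in_verts)
    \<comment> \<open>The path starts at \<open>u\<close> and still reaches \<open>v\<close> after
      the second arc \<open>f\<close>, so a repetition at \<open>snd e\<close> would contradict
      distinctness. Hence \<open>snd e\<close> would be an inner vertex, against
      \<open>inner\<close>.\<close>
    moreover have "snd e \<noteq> u" "snd e \<noteq> v"
      using p(4) pcas_end_in_pawalk_verts[OF f(2)] e(1) f(1) by (auto simp: pe Cons)
    ultimately show ?thesis
      using inner f(1) by (auto simp: pe Cons)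
  qed
  with e show ?thesis
    by (metis prod.collapse)
qed

lemma (in pair_wf_digraph) mutual_visibility_set_pverts_iff:
  "mutual_visibility_set G (pverts G) \<longleftrightarrow>
     (\<forall>u\<in>pverts G. \<forall>v\<in>pverts G. u \<noteq> v \<longrightarrow> (u, v) \<in> parcs G)"
  unfolding mutual_visibility_set_def
  by (blast intro: visible_if_arc dest: visible_pverts_imp_arc)

text \<open>\<open>Max\<close> is informative only on a finite set. Here the candidates lie in the
  power set of the vertices, so a largest candidate determines the value.\<close>

lemma mutual_visibility_number_eqI:
  assumes "finite (pverts G)" "mutual_visibility_set G X"
    and "\<And>Y. mutual_visibility_set G Y \<Longrightarrow> card Y \<le> card X"
  shows "mutual_visibility_number G = card X"
proof -
  have "{Y. mutual_visibility_set G Y} \<subseteq> Pow (pverts G)"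
    by (auto simp: mutual_visibility_set_def)
  then have "finite {Y. mutual_visibility_set G Y}"
    using assms(1) by (meson finite_Pow_iff finite_subset)
  then show ?thesis
    unfolding mutual_visibility_number_def using assms(2,3) by (intro Max_eqI) auto
qed

lemma (in pair_graph) mutual_visibility_number_complete:
  assumes "\<And>u v. u \<in> pverts G \<Longrightarrow> v \<in> pverts G \<Longrightarrow> u \<noteq> v \<Longrightarrow> (u, v) \<in> parcs G"
  shows "mutual_visibility_number G = card (pverts G)"
proof (rule mutual_visibility_number_eqI)
  show "mutual_visibility_set G (pverts G)"
    using assms by (simp add: mutual_visibility_set_pverts_iff)
  show "card Y \<le> card (pverts G)" if "mutual_visibility_set G Y" for Y
    using that pair_finite_verts by (simp add: mutual_visibility_set_def card_mono)
qed (rule pair_finite_verts)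

lemma (in pair_graph) mutual_visibility_number_universal_vertex:
  assumes c: "c \<in> pverts G" "\<And>v. v \<in> pverts G \<Longrightarrow> v \<noteq> c \<Longrightarrow> (c, v) \<in> parcs G"
    and xy: "x \<in> pverts G" "y \<in> pverts G" "x \<noteq> y" "(x, y) \<notin> parcs G"
  shows "mutual_visibility_number G = card (pverts G) - 1"
proof -
  let ?X = "pverts G - {c}"
  have "mutual_visibility_number G = card ?X"
  proof (rule mutual_visibility_number_eqI)
    have "visible G ?X u v" if "u \<in> ?X" "v \<in> ?X" "u \<noteq> v" for u v
    proof (rule visible_through)
      show "(u, c) \<in> parcs G" "(c, v) \<in> parcs G"
        using that c(2) by (auto intro: arcs_symmetric)
    qed (use that in auto)
    then show "mutual_visibility_set G ?X"
      by (auto simp: mutual_visibility_set_def)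
    show "card Y \<le> card ?X" if Y: "mutual_visibility_set G Y" for Y
    proof -
      \<comment> \<open>The nonadjacent pair \<open>x\<close>, \<open>y\<close> excludes the whole
        vertex set. So \<open>Y\<close> misses at least one vertex, while \<open>?X\<close> misses
        exactly one.\<close>
      have "Y \<noteq> pverts G"
        using Y xy by (auto simp: mutual_visibility_set_pverts_iff)
      then have "Y \<subset> pverts G"
        using Y by (auto simp: mutual_visibility_set_def)
      then have "card Y < card (pverts G)"
        by (rule psubset_card_mono[OF pair_finite_verts])
      then show ?thesis
        using c(1) pair_finite_verts by simp
    qed
  qed (rule pair_finite_verts)
  then show ?thesis
    using c(1) pair_finite_verts by simp
qed

theorem mainTheorem10:
  fixes G :: "'a pair_pre_digraph" and H :: "'b pair_pre_digraph" and m :: nat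
  assumes "complete_digraph 1 (with_proj G)"
    and "pair_graph H"
    and "Digraph_Component.connected (with_proj H)"
    and "card (pverts H) = m"
    and "m \<ge> 1"
  shows "(complete_digraph m (with_proj H) \<longrightarrow> mutual_visibility_number (G \<odot> H) = m + 1) \<and>
         (\<not> complete_digraph m (with_proj H) \<longrightarrow> mutual_visibility_number (G \<odot> H) = m)"
proof -
  interpret H: pair_graph H by fact
  obtain a where a: "pverts G = {a}"
    using assms(1) by (auto simp: complete_digraph_pair_def card_1_singleton_iff)
  have G: "pair_graph G"
    using assms(1) by (rule pair_graphI_complete)
  interpret K: pair_graph "G \<odot> H"
    using G assms(2) by (rule pair_graph_corona)
  have verts: "pverts (G \<odot> H) = insert (Inl a) (Inr ` Pair a ` pverts H)"
    by (auto simp: corona_def a)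
  have "card (Inr ` Pair a ` pverts H :: ('a + 'a \<times> 'b) set) = m"
    using assms(4) by (simp add: card_image inj_on_def)
  then have card: "card (pverts (G \<odot> H)) = m + 1"
    unfolding verts using H.pair_finite_verts by (subst card_insert_disjoint) auto
  have hub: "(Inl a, v) \<in> parcs (G \<odot> H)" if "v \<in> pverts (G \<odot> H)" "v \<noteq> Inl a" for v
    using that by (auto simp: corona_def a)
  have copy: "(Inr (a, x), Inr (a, y)) \<in> parcs (G \<odot> H) \<longleftrightarrow> (x, y) \<in> parcs H" for x y
    by (auto simp: corona_def a)
  \<comment> \<open>Completeness demands that the arcs be exactly the pairs of distinct vertices.
    One inclusion holds in every loopfree graph, which leaves the condition on the right.\<close>
  have complete_iff: "complete_digraph m (with_proj H) \<longleftrightarrow>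
      (\<forall>x\<in>pverts H. \<forall>y\<in>pverts H. x \<noteq> y \<longrightarrow> (x, y) \<in> parcs H)"
    using assms(4) H.pair_finite_verts
    by (auto simp: complete_digraph_pair_def dest: H.in_arcsD1 H.in_arcsD2 H.no_loops)
  show ?thesis
  proof (intro conjI impI)
    assume H: "complete_digraph m (with_proj H)"
    have "mutual_visibility_number (G \<odot> H) = card (pverts (G \<odot> H))"
    proof (rule K.mutual_visibility_number_complete)
      fix u v assume uv: "u \<in> pverts (G \<odot> H)" "v \<in> pverts (G \<odot> H)" "u \<noteq> v"
      show "(u, v) \<in> parcs (G \<odot> H)"
      proof (cases "u = Inl a \<or> v = Inl a")
        case True
        then show ?thesis
          using uv hub K.arcs_symmetric by metis
      next
        case False
        then show ?thesis
          using uv H unfolding verts complete_iff by (auto simp: copy) blast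
      qed
    qed
    with card show "mutual_visibility_number (G \<odot> H) = m + 1"
      by simp
  next
    assume "\<not> complete_digraph m (with_proj H)"
    then obtain x y where "x \<in> pverts H" "y \<in> pverts H" "x \<noteq> y" "(x, y) \<notin> parcs H"
      unfolding complete_iff by blast
    \<comment> \<open>The corona adds arcs only at \<open>Inl a\<close>, so a nonadjacent pair of
      \<open>H\<close> remains nonadjacent in its copy.\<close>
    then have "mutual_visibility_number (G \<odot> H) = card (pverts (G \<odot> H)) - 1"
      by (intro K.mutual_visibility_number_universal_vertex
          [where c = "Inl a" and x = "Inr (a, x)" and y = "Inr (a, y)"])
        (auto simp: verts copy intro: hub)
    with card show "mutual_visibility_number (G \<odot> H) = m"
      by simp
  qed
qed

end
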